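(* Let $X$ be a compact metric space, $f:X\to X$ a continuous map, and $S\subset X$ an isolated invariant set for $f$ such that $f$ is expansive on $S$. Then there exist index systems for $S$ of arbitrarily small diameter; that is, for every $\eta>0$ there is an index system $\mathcal P=\{(N_a,L_a):a\in\mathcal A\}$ for $S$ with $\operatorname{diam}(N_a)<\eta$ for all $a\in\mathcal A$.
   Context: Throughout, $X$ is a compact metric space and $f:X\to X$ is continuous. $\operatorname{cl}$ and $\operatorname{Int}$ denote closure and interior in $X$. An orbit of $f$ is a bi-infinite sequence $(x_i)_{i\in\mathbb Z}$ in $X$ with $f(x_i)=x_{i+1}$ for all $i\in\mathbb Z$. A set $T$ is invariant if $f(T)=T$. For $I\subset X$, $\operatorname{Inv} I$ is the maximal invariant subset of $I$. A set $S\subset X$ is an isolated invariant set for $f$ if there is a compact set $I$ (an isolating neighborhood for $S$) with $S=\operatorname{Inv} I\subset\operatorname{Int} I$; the same definition is used for other maps and spaces. Let $f\times f:X\times X\to X\times X$ be $(f\times f)(x,y)=(f(x),f(y))$. A continuous map $f:X\to X$ is expansive if the diagonal $1_X=\{(x,x):x\in X\}$ is an isolated invariant set for $f\times f$. For an isolated invariant set $S\subset X$, $f$ is expansive on $S$ if the restriction of $f$ to $S$ is expansive; equivalently, $1_S=\{(x,x):x\in S\}\subset X\times X$ is an isolated invariant set for $f\times f:X\times X\to X\times X$. Given a sequence $\mathcal I=(I_i)_{i\in\mathbb Z}$ of compact sets in $X$, an orbit $(x_i)$ follows $\mathcal I$ if $x_i\in I_i$ for all $i\in\mathbb Z$. The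 sequence $\mathcal I$ is an isolating neighborhood chain if every orbit $(x_i)$ that follows $\mathcal I$ satisfies $x_i\in\operatorname{Int}(I_i)$ for all $i\in\mathbb Z$. For an isolating neighborhood chain $\mathcal I$, $\operatorname{Inv}_0(\mathcal I)$ is the set of $x\in I_0$ for which there is an orbit $(x_i)$ with $x_0=x$ that follows $\mathcal I$. An index system is a finite collection of compact pairs $\mathcal P=\{P_a=(N_a,L_a):a\in\mathcal A\}$ (with $L_a\subset N_a\subset X$ compact) such that: (1) for each $a\in\mathcal A$ there is at least one $b\in\mathcal A$ such that $P_a$ precedes $P_b$, meaning that (a) $L_a$ is a neighborhood in $N_a$ of the exit set $N_{ab}^-=\{x\in N_a: f(x)\notin\operatorname{Int} N_b\}$, and (b) $f(L_a)\cap\operatorname{cl}(N_b\setminus L_b)=\emptyset$; (2) for every sequence $(a_i)_{i\in\mathbb Z}$ in $\mathcal A$ such that $P_{a_i}$ precedes $P_{a_{i+1}}$ for all $i$, the sequence $(\operatorname{cl}(N_{a_i}\setminus L_{a_i}))_{i\in\mathbb Z}$ is an isolating neighborhood chain. A sequence $(a_i)_{i\in\mathbb Z}$ in $\mathcal A$ is allowable if $P_{a_i}$ precedes $P_{a_{i+1}}$ for all $i$. The invariant set of $\mathcal P$ is $\operatorname{Inv}(\mathcal P)=\bigcup\operatorname{Inv}_0\big((\operatorname{cl}(N_{a_i}\setminus L_{a_i}))_{i\in\mathbb Z}\big)$, the union being over all allowable sequences $(a_i)_{i\in\mathbb Z}$. For an isolated invariant set $S$, $\mathcal P$ is an index system for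 $S$ if $\operatorname{Inv}(\mathcal P)=S$. *)

theory Defs
  imports "HOL-Analysis.Analysis"
begin

text \<open>
  A space is a subset \<open>X\<close> of a metric-space type, with the subspace topology
  \<open>top_of_set X\<close>. Interiors and closures are relative to \<open>X\<close>. A self-map of \<open>X\<close>
  is a function on the whole type whose values outside \<open>X\<close> play no role, so the restriction
  of \<open>f\<close> to an invariant subset \<open>S\<close> is \<open>f\<close> itself, with \<open>S\<close> in place of \<open>X\<close>.
\<close>

definition invariant_set :: "('a \<Rightarrow> 'a) \<Rightarrow> 'a set \<Rightarrow> bool" where
  "invariant_set f T \<longleftrightarrow> f ` T = T"

definition Inv :: "('a \<Rightarrow> 'a) \<Rightarrow> 'a set \<Rightarrow> 'a set" where
  "Inv f I = \<Union> {T. T \<subseteq> I \<and> invariant_set f T}"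

lemma Inv_subset: "Inv f I \<subseteq> I"
  by (auto simp: Inv_def)

lemma Inv_invariant: "invariant_set f (Inv f I)"
proof -
  have "f ` Inv f I = \<Union> ((\<lambda>T. f ` T) ` {T. T \<subseteq> I \<and> invariant_set f T})"
    by (simp add: Inv_def image_Union)
  also have "(\<lambda>T. f ` T) ` {T. T \<subseteq> I \<and> invariant_set f T} =
      (\<lambda>T. T) ` {T. T \<subseteq> I \<and> invariant_set f T}"
    by (rule image_cong) (simp_all add: invariant_set_def)
  finally show ?thesis
    by (simp add: invariant_set_def Inv_def)
qed

lemma Inv_greatest: "T \<subseteq> I \<Longrightarrow> invariant_set f T \<Longrightarrow> T \<subseteq> Inv f I"
  by (auto simp: Inv_def)

definition isolated_invariant_set ::
    "'a::topological_space set \<Rightarrow> ('a \<Rightarrow> 'a) \<Rightarrow> 'a set \<Rightarrow> bool" where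
  "isolated_invariant_set X f S \<longleftrightarrow>
     (\<exists>I. I \<subseteq> X \<and> compact I \<and> S = Inv f I \<and> S \<subseteq> (top_of_set X) interior_of I)"

definition expansive :: "'a::topological_space set \<Rightarrow> ('a \<Rightarrow> 'a) \<Rightarrow> bool" where
  "expansive X f \<longleftrightarrow>
     isolated_invariant_set (X \<times> X) (map_prod f f) {(x, x) | x. x \<in> X}"

definition expansive_on :: "('a::topological_space \<Rightarrow> 'a) \<Rightarrow> 'a set \<Rightarrow> bool" where
  "expansive_on f S \<longleftrightarrow> expansive S f"

definition orbit_in :: "'a set \<Rightarrow> ('a \<Rightarrow> 'a) \<Rightarrow> (int \<Rightarrow> 'a) \<Rightarrow> bool" where
  "orbit_in X f x \<longleftrightarrow> (\<forall>i. x i \<in> X \<and> f (x i) = x (i + 1))"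

definition follows :: "(int \<Rightarrow> 'a) \<Rightarrow> (int \<Rightarrow> 'a set) \<Rightarrow> bool" where
  "follows x I \<longleftrightarrow> (\<forall>i. x i \<in> I i)"

definition isolating_neighborhood_chain ::
    "'a::topological_space set \<Rightarrow> ('a \<Rightarrow> 'a) \<Rightarrow> (int \<Rightarrow> 'a set) \<Rightarrow> bool" where
  "isolating_neighborhood_chain X f I \<longleftrightarrow>
     (\<forall>i. I i \<subseteq> X \<and> compact (I i)) \<and>
     (\<forall>x. orbit_in X f x \<and> follows x I \<longrightarrow> (\<forall>i. x i \<in> (top_of_set X) interior_of (I i)))"

definition Inv0 :: "'a set \<Rightarrow> ('a \<Rightarrow> 'a) \<Rightarrow> (int \<Rightarrow> 'a set) \<Rightarrow> 'a set" where
  "Inv0 X f I = {y \<in> I 0. \<exists>x. orbit_in X f x \<and> x 0 = y \<and> follows x I}"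

definition exit_set ::
    "'a::topological_space set \<Rightarrow> ('a \<Rightarrow> 'a) \<Rightarrow> 'a set \<Rightarrow> 'a set \<Rightarrow> 'a set" where
  "exit_set X f Na Nb = {x \<in> Na. f x \<notin> (top_of_set X) interior_of Nb}"

definition precedes :: "'a::topological_space set \<Rightarrow> ('a \<Rightarrow> 'a) \<Rightarrow>
    'a set \<times> 'a set \<Rightarrow> 'a set \<times> 'a set \<Rightarrow> bool" where
  "precedes X f = (\<lambda>(Na, La) (Nb, Lb).
     exit_set X f Na Nb \<subseteq> (top_of_set Na) interior_of La \<and>
     f ` La \<inter> (top_of_set X) closure_of (Nb - Lb) = {})"

definition allowable :: "'a::topological_space set \<Rightarrow> ('a \<Rightarrow> 'a) \<Rightarrow> 'i set \<Rightarrow>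
    ('i \<Rightarrow> 'a set) \<Rightarrow> ('i \<Rightarrow> 'a set) \<Rightarrow> (int \<Rightarrow> 'i) \<Rightarrow> bool" where
  "allowable X f A N L a \<longleftrightarrow>
     (\<forall>i. a i \<in> A \<and> precedes X f (N (a i), L (a i)) (N (a (i + 1)), L (a (i + 1))))"

definition difference_chain :: "'a::topological_space set \<Rightarrow>
    ('i \<Rightarrow> 'a set) \<Rightarrow> ('i \<Rightarrow> 'a set) \<Rightarrow> (int \<Rightarrow> 'i) \<Rightarrow> int \<Rightarrow> 'a set" where
  "difference_chain X N L a = (\<lambda>i. (top_of_set X) closure_of (N (a i) - L (a i)))"

definition index_system :: "'a::topological_space set \<Rightarrow> ('a \<Rightarrow> 'a) \<Rightarrow> 'i set \<Rightarrow>
    ('i \<Rightarrow> 'a set) \<Rightarrow> ('i \<Rightarrow> 'a set) \<Rightarrow> bool" where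
  "index_system X f A N L \<longleftrightarrow>
     finite A \<and>
     (\<forall>a\<in>A. compact (N a) \<and> compact (L a) \<and> L a \<subseteq> N a \<and> N a \<subseteq> X) \<and>
     (\<forall>a\<in>A. \<exists>b\<in>A. precedes X f (N a, L a) (N b, L b)) \<and>
     (\<forall>a. allowable X f A N L a \<longrightarrow>
        isolating_neighborhood_chain X f (difference_chain X N L a))"

definition Inv_system :: "'a::topological_space set \<Rightarrow> ('a \<Rightarrow> 'a) \<Rightarrow> 'i set \<Rightarrow>
    ('i \<Rightarrow> 'a set) \<Rightarrow> ('i \<Rightarrow> 'a set) \<Rightarrow> 'a set" where
  "Inv_system X f A N L =
     \<Union> {Inv0 X f (difference_chain X N L a) | a. allowable X f A N L a}"

definition index_system_for :: "'a::topological_space set \<Rightarrow> ('a \<Rightarrow> 'a) \<Rightarrow> 'a set \<Rightarrow>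
    'i set \<Rightarrow> ('i \<Rightarrow> 'a set) \<Rightarrow> ('i \<Rightarrow> 'a set) \<Rightarrow> bool" where
  "index_system_for X f S A N L \<longleftrightarrow>
     index_system X f A N L \<and> Inv_system X f A N L = S"

end

theory Submission
  imports Defs
begin

text \<open>
  By expansiveness the diagonal of \<open>S\<close> is an isolated invariant set of \<open>f \<times> f\<close>, with isolating
  neighbourhoods \<open>M\<close> arbitrarily close to the diagonal. For small \<open>e\<close> let \<open>A\<close> be the set of points of
  \<open>M\<close> reachable from the diagonal by \<open>e\<close>-chains in \<open>M\<close>, and \<open>B\<close> the set of points from which the
  diagonal is reachable. Then \<open>P = closure A\<close> and \<open>Q = P - B\<close> form a filtration pair, i.e.
  \<open>closure (P - Q)\<close> is mapped into the interior of \<open>P\<close>, and \<open>Q\<close> is mapped off \<open>closure (P - Q)\<close>: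
  as \<open>e\<close> tends to 0 the sets \<open>closure A \<inter> closure B\<close> decrease to an invariant subset of \<open>M\<close>, so for
  small \<open>e\<close> they lie close to the diagonal of \<open>S\<close> and their images lie in the interior of \<open>M\<close>.
  The fibre \<open>(P\<^sub>x, Q\<^sub>x)\<close> precedes \<open>(P\<^sub>y, Q\<^sub>y)\<close> as soon as \<open>y\<close> is close to \<open>f x\<close>, by compactness, so
  the fibres over a finite net of \<open>S\<close> form an index system. That allowable sequences give isolating
  neighbourhood chains is automatic from the definition of precedence.
\<close>

section \<open>Maximal invariant sets\<close>

lemma image_Inv: "f ` Inv f I = Inv f I"
  using Inv_invariant[of f I] by (simp add: invariant_set_def)

lemma compact_closure_subset:
  fixes T :: "'a::t2_space set"
  assumes "compact T" "S \<subseteq> T"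
  shows "closure S \<subseteq> T" "compact (closure S)"
proof -
  show *: "closure S \<subseteq> T"
    using assms by (simp add: closure_minimal compact_imp_closed)
  show "compact (closure S)"
    using assms(1) * by (metis closed_closure compact_Int_closed inf.absorb2)
qed

text \<open>The closure of an invariant set in a compact set is again invariant: continuity gives
  one inclusion, compactness of the image the other. By maximality \<open>Inv f I\<close> equals its
  closure.\<close>

lemma compact_Inv:
  fixes I :: "'a::metric_space set"
  assumes "compact I" "continuous_on I f"
  shows "compact (Inv f I)"
proof -
  note sub = compact_closure_subset(1)[OF assms(1) Inv_subset]
    and com = compact_closure_subset(2)[OF assms(1) Inv_subset]
  have cont: "continuous_on (closure (Inv f I)) f"
    using assms(2) sub continuous_on_subset by blast
  have "f ` closure (Inv f I) \<subseteq> closure (Inv f I)"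
    using image_closure_subset[OF cont closed_closure] closure_subset[of "Inv f I"]
    by (simp add: image_Inv)
  moreover have "closure (Inv f I) \<subseteq> f ` closure (Inv f I)"
  proof (rule closure_minimal)
    show "Inv f I \<subseteq> f ` closure (Inv f I)"
      using image_Inv[of f I] closure_subset[of "Inv f I"] by blast
    show "closed (f ` closure (Inv f I))"
      using compact_continuous_image[OF cont com] compact_imp_closed by blast
  qed
  ultimately have "invariant_set f (closure (Inv f I))"
    by (auto simp: invariant_set_def)
  then have "closure (Inv f I) \<subseteq> Inv f I"
    by (rule Inv_greatest[OF sub])
  then show ?thesis
    using com closure_subset by (metis subset_antisym)
qed

text \<open>The range of a bi-infinite orbit is an invariant set, since every \<open>x i\<close> has
  the preimage \<open>x (i - 1)\<close> in it.\<close>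

lemma orbit_in_Inv:
  assumes "orbit_in X f x" "\<And>i. x i \<in> I"
  shows "x i \<in> Inv f I"
proof -
  have "f ` range x = range x"
  proof
    show "f ` range x \<subseteq> range x"
      using assms(1) by (auto simp: orbit_in_def)
    show "range x \<subseteq> f ` range x"
    proof
      fix y assume "y \<in> range x"
      then obtain i where "y = x i" by blast
      then have "y = f (x (i - 1))"
        using assms(1) by (simp add: orbit_in_def)
      then show "y \<in> f ` range x" by blast
    qed
  qed
  then have "range x \<subseteq> Inv f I"
    using assms(2) by (intro Inv_greatest) (auto simp: invariant_set_def)
  then show ?thesis by blast
qed

text \<open>Surjectivity of \<open>f\<close> on \<open>S\<close> provides a right inverse
  \<open>g\<close>; the orbit runs forward by \<open>f\<close> and backward by
  \<open>g\<close>.\<close>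

lemma orbit_through_point:
  assumes "f ` S = S" "y \<in> S"
  obtains x where "orbit_in S f x" "x 0 = y"
proof -
  define g where "g = inv_into S f"
  have g: "g s \<in> S \<and> f (g s) = s" if "s \<in> S" for s
    using that assms(1) by (simp add: g_def inv_into_into f_inv_into_f)
  define x where "x i = (if i \<ge> 0 then (f ^^ nat i) y else (g ^^ nat (- i)) y)" for i
  have fS: "(f ^^ n) y \<in> S" for n
  proof (induction n)
    case (Suc n)
    then show ?case using assms(1) imageI[of "(f ^^ n) y" S f] by simp
  qed (use assms(2) in simp)
  have gS: "(g ^^ n) y \<in> S" for n
  proof (induction n)
    case (Suc n)
    then show ?case using g[of "(g ^^ n) y"] by simp
  qed (use assms(2) in simp)
  have "f (x i) = x (i + 1)" for i
  proof (cases "i \<ge> 0")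
    case True
    then show ?thesis by (simp add: x_def nat_add_distrib)
  next
    case False
    then obtain n where n: "i = - int (Suc n)"
      using negD[of i] by auto
    have "f (x i) = (g ^^ n) y"
      using g gS by (simp add: x_def n nat_add_distrib)
    \<comment> \<open>Here \<open>i + 1\<close> is \<open>- int n\<close>, which for
      \<open>n = 0\<close> already belongs to the forward branch of \<open>x\<close>.\<close>
    also have "\<dots> = x (i + 1)"
      by (cases n) (auto simp: x_def n nat_add_distrib)
    finally show ?thesis .
  qed
  then have "orbit_in S f x"
    using fS gS by (auto simp: orbit_in_def x_def)
  then show thesis
    using that by (simp add: x_def)
qed

section \<open>Filtration pairs from chains\<close>

text \<open>End points of \<open>e\<close>-pseudo-orbits in \<open>M\<close> that start in
  \<open>K\<close>. The strict bound on the jump makes the set relatively open.\<close>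

inductive_set chain_from :: "('a::metric_space \<Rightarrow> 'a) \<Rightarrow> 'a set \<Rightarrow> 'a set \<Rightarrow> real \<Rightarrow> 'a set"
  for F M K e where
  base: "z \<in> K \<Longrightarrow> z \<in> chain_from F M K e"
| step: "z \<in> chain_from F M K e \<Longrightarrow> w \<in> M \<Longrightarrow> dist (F z) w < e \<Longrightarrow> w \<in> chain_from F M K e"

text \<open>The dual set: starting points of \<open>e\<close>-pseudo-orbits that end in
  \<open>K\<close>.\<close>

inductive_set chain_to :: "('a::metric_space \<Rightarrow> 'a) \<Rightarrow> 'a set \<Rightarrow> 'a set \<Rightarrow> real \<Rightarrow> 'a set"
  for F M K e where
  base: "z \<in> K \<Longrightarrow> z \<in> chain_to F M K e"
| step: "w \<in> chain_to F M K e \<Longrightarrow> z \<in> M \<Longrightarrow> dist (F z) w < e \<Longrightarrow> z \<in> chain_to F M K e"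

lemma chain_from_mono: "e \<le> e' \<Longrightarrow> chain_from F M K e \<subseteq> chain_from F M K e'"
proof
  fix z assume "e \<le> e'" "z \<in> chain_from F M K e"
  from this(2,1) show "z \<in> chain_from F M K e'"
    by induction (auto intro: chain_from.intros)
qed

lemma chain_to_mono: "e \<le> e' \<Longrightarrow> chain_to F M K e \<subseteq> chain_to F M K e'"
proof
  fix z assume "e \<le> e'" "z \<in> chain_to F M K e"
  from this(2,1) show "z \<in> chain_to F M K e'"
    by induction (auto intro: chain_to.intros)
qed

text \<open>In the application \<open>F\<close> is \<open>map_prod f f\<close> and \<open>M\<close>
  a neighbourhood of the diagonal of \<open>S\<close>. The set \<open>M\<close> need not be mapped
  into itself.\<close>

locale compact_domain =
  fixes F :: "'a::metric_space \<Rightarrow> 'a" and M :: "'a set"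
  assumes compact_M: "compact M" and cont_M: "continuous_on M F"
begin

abbreviation "K \<equiv> Inv F M"
abbreviation "A \<equiv> chain_from F M K"
abbreviation "B \<equiv> chain_to F M K"

section \<open>Single steps of chains and openness of the chain sets\<close>

lemma A_subset: "A e \<subseteq> M"
proof
  fix z assume "z \<in> A e"
  then show "z \<in> M" by induction (use Inv_subset[of F M] in auto)
qed

lemma B_subset: "B e \<subseteq> M"
proof
  fix z assume "z \<in> B e"
  then show "z \<in> M" by induction (use Inv_subset[of F M] in auto)
qed

lemma closure_A_subset: "closure (A e) \<subseteq> M"
  by (rule compact_closure_subset(1)[OF compact_M A_subset])

lemma closure_B_subset: "closure (B e) \<subseteq> M"
  by (rule compact_closure_subset(1)[OF compact_M B_subset])

text \<open>Chains of length zero also have a predecessor, because points of \<open>K\<close> have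
  exact preimages in \<open>K\<close>.\<close>

lemma A_pred:
  assumes "0 < e" "w \<in> A e"
  obtains z where "z \<in> A e" "dist (F z) w < e"
  using assms(2)
proof cases
  case base
  then obtain z where "z \<in> K" "w = F z"
    using image_Inv[of F M] by auto
  then show thesis
    using that[of z] assms(1) by (simp add: chain_from.base)
qed (use that in blast)

lemma B_succ:
  assumes "0 < e" "z \<in> B e"
  obtains w where "w \<in> B e" "dist (F z) w < e"
  using assms(2)
proof cases
  case base
  then have "F z \<in> K"
    using image_Inv[of F M] by auto
  then show thesis
    using that[of "F z"] assms(1) by (simp add: chain_to.base)
qed (use that in blast)

text \<open>The strict inequality leaves room to replace \<open>z\<close> by a nearby point of
  \<open>A e\<close>, so a jump from the closure already lands in \<open>A e\<close>.\<close>

lemma closure_A_step: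
  assumes "z \<in> closure (A e)" "w \<in> M" "dist (F z) w < e"
  shows "w \<in> A e"
proof -
  have "z \<in> M" using assms(1) closure_A_subset by blast
  moreover have "0 < e - dist (F z) w" using assms(3) by simp
  ultimately obtain d where d: "d > 0"
    "\<And>v. v \<in> M \<Longrightarrow> dist v z < d \<Longrightarrow> dist (F v) (F z) < e - dist (F z) w"
    using cont_M unfolding continuous_on_iff by metis
  obtain v where v: "v \<in> A e" "dist v z < d"
    using assms(1) d(1) by (auto simp: closure_approachable)
  then have "dist (F v) (F z) < e - dist (F z) w"
    using d(2) A_subset by blast
  then have "dist (F v) w < e"
    using dist_triangle[of "F v" w "F z"] by simp
  then show ?thesis
    using v(1) assms(2) chain_from.step by metis
qed

text \<open>A point of \<open>B e\<close> within \<open>e\<close> of \<open>F z\<close> is a legal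
  next point after \<open>z\<close>.\<close>

lemma closure_B_step:
  assumes "F z \<in> closure (B e)" "z \<in> M" "0 < e"
  shows "z \<in> B e"
proof -
  obtain w where "w \<in> B e" "dist w (F z) < e"
    using assms by (auto simp: closure_approachable)
  then show ?thesis
    using assms(2) chain_to.step by (metis dist_commute)
qed

text \<open>The last jump may end anywhere in \<open>M\<close> within \<open>e\<close> of
  \<open>F z\<close>.\<close>

lemma openin_A:
  assumes "0 < e"
  shows "openin (top_of_set M) (A e)"
proof (subst openin_subopen, intro ballI)
  fix w assume "w \<in> A e"
  then obtain z where z: "z \<in> A e" "dist (F z) w < e"
    using A_pred[OF assms] by metis
  show "\<exists>T. openin (top_of_set M) T \<and> w \<in> T \<and> T \<subseteq> A e"
  proof (intro exI conjI)
    show "openin (top_of_set M) (M \<inter> ball (F z) e)" by auto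
    show "w \<in> M \<inter> ball (F z) e" using \<open>w \<in> A e\<close> A_subset z(2) by auto
    show "M \<inter> ball (F z) e \<subseteq> A e" using z(1) by (auto intro: chain_from.step)
  qed
qed

lemma openin_B:
  assumes "0 < e"
  shows "openin (top_of_set M) (B e)"
proof (subst openin_subopen, intro ballI)
  fix z assume "z \<in> B e"
  then obtain w where w: "w \<in> B e" "dist (F z) w < e"
    using B_succ[OF assms] by metis
  show "\<exists>T. openin (top_of_set M) T \<and> z \<in> T \<and> T \<subseteq> B e"
  proof (intro exI conjI)
    show "openin (top_of_set M) (M \<inter> F -` ball w e)"
      using cont_M by (rule continuous_openin_preimage_gen) simp
    show "z \<in> M \<inter> F -` ball w e" using \<open>z \<in> B e\<close> B_subset w(2) by (auto simp: dist_commute)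
    show "M \<inter> F -` ball w e \<subseteq> B e"
      using w(1) by (auto intro: chain_to.step simp: dist_commute)
  qed
qed

text \<open>As the jumps shrink to 0, chains turn into true orbits, so the intersection is
  invariant, and maximality of \<open>K\<close> applies. Its image is controlled by successors in
  \<open>B\<close>, its preimages by a limit of predecessors in \<open>A\<close>.\<close>

lemma Inter_closure_chains_subset:
  "(\<Inter>e\<in>{0<..}. closure (A e) \<inter> closure (B e)) \<subseteq> K"
proof (rule Inv_greatest)
  let ?T = "\<Inter>e\<in>{0<..}. closure (A e) \<inter> closure (B e)"
  show TM: "?T \<subseteq> M"
    using closure_A_subset[of 1] by auto
  have "F z \<in> ?T" if z: "z \<in> ?T" for z
  proof -
    have zM: "z \<in> M" using z TM by blast
    have FB: "F z \<in> closure (B e)" if e: "0 < e" for e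
      unfolding closure_approachable
    proof (intro allI impI)
      fix r :: real assume r: "0 < r"
      \<comment> \<open>The bound \<open>e\<close> keeps the successor in \<open>B e\<close>; the
        bound \<open>r / 2\<close> on the jump is added to the \<open>r / 2\<close> coming from
        continuity.\<close>
      define s where "s = min e (r / 2)"
      have s: "0 < s" "s \<le> e" "s \<le> r / 2" using e r by (auto simp: s_def)
      obtain d where d: "d > 0" "\<And>v. v \<in> M \<Longrightarrow> dist v z < d \<Longrightarrow> dist (F v) (F z) < r / 2"
        using cont_M zM r unfolding continuous_on_iff by (metis half_gt_zero)
      obtain v where v: "v \<in> B s" "dist v z < d"
      proof -
        have "z \<in> closure (B s)" using z s(1) by blast
        then show thesis using that d(1) unfolding closure_approachable by blast
      qed
      obtain w where w: "w \<in> B s" "dist (F v) w < s"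
        using B_succ[OF s(1) v(1)] by metis
      have "dist (F v) (F z) < r / 2" using d(2) v B_subset by blast
      then have "dist w (F z) < r"
        using w(2) s(3) dist_triangle3[of w "F z" "F v"] by simp
      then show "\<exists>y\<in>B e. dist y (F z) < r"
        using w(1) chain_to_mono[OF s(2)] by blast
    qed
    then have "F z \<in> M" using closure_B_subset[of 1] by (meson subsetD zero_less_one)
    \<comment> \<open>A jump of size 0, legal once \<open>F z\<close> is known to lie in
      \<open>M\<close>.\<close>
    then have "F z \<in> A e" if "0 < e" for e
      using closure_A_step[of z e "F z"] z that by simp
    then show ?thesis
      using FB closure_subset[of "A _"] by blast
  qed
  moreover have "z \<in> F ` ?T" if z: "z \<in> ?T" for z
  proof -
    \<comment> \<open>One \<open>1 / Suc n\<close> is for approximating \<open>z\<close> by a point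
      of \<open>A\<close>, the other for the jump onto that point. A limit \<open>q\<close> of these
      \<open>p\<close> will be the preimage of \<open>z\<close>.\<close>
    have "\<exists>p. p \<in> A (1 / Suc n) \<and> dist (F p) z < 2 / Suc n" for n
    proof -
      have e: "0 < 1 / real (Suc n)" by simp
      obtain w where w: "w \<in> A (1 / Suc n)" "dist w z < 1 / Suc n"
      proof -
        have "z \<in> closure (A (1 / Suc n))" using z e by blast
        then show thesis using that e unfolding closure_approachable by blast
      qed
      obtain p where p: "p \<in> A (1 / Suc n)" "dist (F p) w < 1 / Suc n"
        using A_pred[OF e w(1)] by metis
      have "dist (F p) z < 1 / Suc n + 1 / Suc n"
        using w(2) p(2) dist_triangle[of "F p" z w] by linarith
      then show ?thesis using p(1) by auto
    qed
    then obtain p where p: "\<And>n. p n \<in> A (1 / Suc n)" "\<And>n. dist (F (p n)) z < 2 / Suc n"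
      by metis
    have pM: "p n \<in> M" for n using p(1) A_subset by blast
    obtain q r where q: "q \<in> M" "strict_mono r" "(p \<circ> r) \<longlonglongrightarrow> q"
      using compact_M pM unfolding compact_def by metis
    have "(\<lambda>n. F ((p \<circ> r) n)) \<longlonglongrightarrow> F q"
      by (rule continuous_on_tendsto_compose[OF cont_M q(3,1)]) (simp add: pM)
    moreover have "(\<lambda>n. F ((p \<circ> r) n)) \<longlonglongrightarrow> z"
    proof -
      have "(\<lambda>n. 2 * (1 / real (Suc n))) \<longlonglongrightarrow> 2 * 0"
        by (intro tendsto_mult tendsto_const LIMSEQ_Suc lim_1_over_n)
      then have lim: "(\<lambda>n. 2 / real (Suc n)) \<longlonglongrightarrow> 0" by simp
      have "(\<lambda>n. dist (F (p n)) z) \<longlonglongrightarrow> 0"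
        by (rule tendsto_sandwich[OF _ _ tendsto_const lim])
          (use p(2) in \<open>auto intro!: always_eventually less_imp_le\<close>)
      then have "(\<lambda>n. F (p n)) \<longlonglongrightarrow> z"
        by (rule iffD2[OF tendsto_dist_iff])
      then show ?thesis
        using LIMSEQ_subseq_LIMSEQ[OF _ q(2), of "\<lambda>n. F (p n)" z] by (simp add: o_def)
    qed
    ultimately have Fq: "F q = z" using LIMSEQ_unique by blast
    have qA: "q \<in> closure (A e)" if e: "0 < e" for e
    proof -
      obtain k where k: "1 / Suc k < e"
        using e nat_approx_posE by blast
      have "(p \<circ> r) n \<in> closure (A e)" if "k \<le> n" for n
      proof -
        have "k \<le> r n" using that seq_suble[OF q(2), of n] by linarith
        then have "1 / real (Suc (r n)) \<le> 1 / real (Suc k)"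
          by (intro divide_left_mono) auto
        then have "1 / Suc (r n) \<le> e" using k by linarith
        then show ?thesis
          using p(1)[of "r n"] chain_from_mono[of "1 / Suc (r n)" e F M K] closure_subset[of "A e"] by auto
      qed
      then show ?thesis
        using q(3) by (intro Lim_in_closed_set[of "closure (A e)" "p \<circ> r" sequentially])
          (auto simp: eventually_sequentially)
    qed
    \<comment> \<open>Membership on the \<open>B\<close> side is pulled back from
      \<open>F q = z\<close>.\<close>
    have "q \<in> B e" if "0 < e" for e
      using closure_B_step[of q e] Fq z q(1) that by simp
    then have "q \<in> ?T" using qA closure_subset[of "B _"] by blast
    then show ?thesis using Fq by blast
  qed
  ultimately show "invariant_set F ?T"
    unfolding invariant_set_def by (intro equalityI image_subsetI subsetI)
qed

text \<open>Otherwise points outside \<open>G\<close> for jump sizes tending to 0 accumulate in the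
  compact set \<open>M - G\<close> at a point of all the closures, hence of
  \<open>K\<close>.\<close>

lemma closure_chains_subset_open:
  assumes "openin (top_of_set M) G" "K \<subseteq> G"
  shows "\<exists>e>0. closure (A e) \<inter> closure (B e) \<subseteq> G"
proof (rule ccontr)
  assume "\<not> ?thesis"
  then have "\<exists>z. z \<in> closure (A e) \<inter> closure (B e) - G" if "0 < e" for e
    using that by blast
  then have "\<exists>z. z \<in> closure (A (1 / Suc n)) \<inter> closure (B (1 / Suc n)) - G" for n
    by simp
  then obtain z where z: "\<And>n. z n \<in> closure (A (1 / Suc n)) \<inter> closure (B (1 / Suc n)) - G"
    by metis
  have "closedin (top_of_set M) (M - G)"
    using assms(1) by (auto intro: closedin_diff)
  then have com: "compact (M - G)"
    using compact_M by (simp add: closedin_compact)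
  have "z n \<in> M - G" for n using z closure_A_subset by blast
  then obtain q r where q: "q \<in> M - G" "strict_mono r" "(z \<circ> r) \<longlonglongrightarrow> q"
    using com unfolding compact_def by metis
  have "q \<in> closure (A e) \<inter> closure (B e)" if e: "0 < e" for e
  proof -
    obtain k where k: "1 / Suc k < e"
      using e nat_approx_posE by blast
    have "(z \<circ> r) n \<in> closure (A e) \<inter> closure (B e)" if "k \<le> n" for n
    proof -
      have "k \<le> r n" using that seq_suble[OF q(2), of n] by linarith
      then have "1 / real (Suc (r n)) \<le> 1 / real (Suc k)"
        by (intro divide_left_mono) auto
      then have "1 / Suc (r n) \<le> e" using k by linarith
      then show ?thesis
        using z[of "r n"] closure_mono[OF chain_from_mono] closure_mono[OF chain_to_mono]
        by fastforce
    qed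
    then show ?thesis
      using q(3) by (intro Lim_in_closed_set[of _ "z \<circ> r" sequentially])
        (auto simp: eventually_sequentially)
  qed
  then have "q \<in> K" using Inter_closure_chains_subset by blast
  then show False using assms(2) q(1) by blast
qed

text \<open>\<open>P\<close> absorbs small jumps from \<open>closure (A e)\<close> that land in
  \<open>M\<close>, and no point outside \<open>B e\<close> can jump into \<open>B e\<close>.
  Smallness of \<open>e\<close> ensures that images of \<open>closure (P - Q)\<close> stay in the
  interior of \<open>M\<close>, where such jumps are allowed.\<close>

lemma filtration_pair:
  assumes "F ` Z \<subseteq> Z" "M \<subseteq> Z" and isol: "K \<subseteq> (top_of_set Z) interior_of M"
  obtains P Q where "compact P" "compact Q" "Q \<subseteq> P" "P \<subseteq> M"
    "F ` closure (P - Q) \<subseteq> (top_of_set Z) interior_of P"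
    "F ` Q \<inter> closure (P - Q) = {}"
    "K \<subseteq> (top_of_set Z) interior_of (P - Q)"
proof -
  obtain U where U: "open U" "(top_of_set Z) interior_of M = Z \<inter> U"
    by (metis openin_interior_of openin_open)
  have UM: "Z \<inter> U \<subseteq> M" using U(2) interior_of_subset by metis
  \<comment> \<open>The open set to be reached consists of the points that \<open>F\<close> sends
    into the interior of \<open>M\<close>; it contains \<open>K\<close> by invariance.\<close>
  have "openin (top_of_set M) (M \<inter> F -` U)"
    using cont_M U(1) continuous_openin_preimage_gen by blast
  moreover have "K \<subseteq> M \<inter> F -` U"
    using isol U(2) image_Inv[of F M] Inv_subset[of F M] by blast
  ultimately obtain e where e: "0 < e" "closure (A e) \<inter> closure (B e) \<subseteq> M \<inter> F -` U"
    using closure_chains_subset_open by metis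
  define P Q where "P = closure (A e)" and "Q = P - B e"
  have P: "compact P" "P \<subseteq> M"
    unfolding P_def by (rule compact_closure_subset[OF compact_M A_subset])+
  obtain V where V: "open V" "B e = M \<inter> V"
    using openin_B[OF e(1)] by (auto simp: openin_open)
  obtain W where W: "open W" "A e = M \<inter> W"
    using openin_A[OF e(1)] by (auto simp: openin_open)
  have "Q = P - V" using P(2) V(2) by (auto simp: Q_def)
  then have Q: "compact Q" using P(1) V(1) by (simp add: compact_diff)
  have PQ: "P - Q = P \<inter> B e" by (auto simp: Q_def)
  have E: "closure (P - Q) \<subseteq> closure (A e) \<inter> closure (B e)"
    unfolding PQ by (simp add: P_def closure_minimal closure_mono le_infI2)
  show thesis
  proof (rule that[OF P(1) Q _ P(2)])
    show "Q \<subseteq> P" by (auto simp: Q_def)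
    show "F ` closure (P - Q) \<subseteq> (top_of_set Z) interior_of P"
    proof (rule image_subsetI)
      fix z assume "z \<in> closure (P - Q)"
      then have z: "z \<in> closure (A e)" "z \<in> M" "F z \<in> U" using E e(2) by blast+
      \<comment> \<open>Points of \<open>Z\<close> in \<open>U\<close> lie in \<open>M\<close>;
        within \<open>e\<close> of \<open>F z\<close> they are next points of a chain, so
        \<open>P\<close> contains a neighbourhood of \<open>F z\<close>.\<close>
      have "Z \<inter> (U \<inter> ball (F z) e) \<subseteq> P"
      proof
        fix w assume "w \<in> Z \<inter> (U \<inter> ball (F z) e)"
        then have "w \<in> A e" using closure_A_step[OF z(1), of w] UM by auto
        then show "w \<in> P" using closure_subset by (auto simp: P_def)
      qed
      then have "Z \<inter> (U \<inter> ball (F z) e) \<subseteq> (top_of_set Z) interior_of P"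
        using U(1) by (intro interior_of_maximal) auto
      moreover have "F z \<in> Z" using assms(1,2) z(2) by blast
      ultimately show "F z \<in> (top_of_set Z) interior_of P" using z(3) e(1) by auto
    qed
    show "F ` Q \<inter> closure (P - Q) = {}"
    proof -
      have False if "z \<in> Q" "F z \<in> closure (P - Q)" for z
      proof -
        \<comment> \<open>The image lies in \<open>closure (B e)\<close>, so \<open>z\<close> itself
          would be in \<open>B e\<close>, which \<open>Q\<close> excludes.\<close>
        have "z \<in> B e"
          by (rule closure_B_step) (use that E P(2) e(1) in \<open>auto simp: Q_def\<close>)
        then show False using that(1) by (simp add: Q_def)
      qed
      then show ?thesis by blast
    qed
    show "K \<subseteq> (top_of_set Z) interior_of (P - Q)"
    proof -
      have "Z \<inter> (U \<inter> V \<inter> W) \<subseteq> P - Q"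
        using UM V(2) W(2) closure_subset[of "A e"] unfolding PQ by (auto simp: P_def)
      then have "Z \<inter> (U \<inter> V \<inter> W) \<subseteq> (top_of_set Z) interior_of (P - Q)"
        using U(1) V(1) W(1) by (intro interior_of_maximal) auto
      moreover have "K \<subseteq> A e" "K \<subseteq> B e"
        by (auto intro: chain_from.base chain_to.base)
      ultimately show ?thesis using isol U(2) V(2) W(2) by blast
    qed
  qed
qed

end


section \<open>Isolation of the diagonal\<close>

text \<open>Expansiveness isolates the diagonal only inside \<open>S \<times> S\<close>. Isolation
  of \<open>S\<close> lifts this to \<open>X \<times> X\<close>: both projections of an invariant
  subset of \<open>I \<times> I\<close> are invariant in \<open>I\<close>, hence contained in
  \<open>S\<close>.\<close>

lemma isolated_diagonal:
  fixes X S :: "'a::metric_space set"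
  assumes contf: "continuous_on X f" and isol: "isolated_invariant_set X f S"
    and exps: "expansive_on f S" and "0 < \<eta>"
  obtains I M where "I \<subseteq> X" "compact I" "S = Inv f I" "compact M" "M \<subseteq> I \<times> I"
    "M \<subseteq> {p. dist (fst p) (snd p) \<le> \<eta>}"
    "Inv (map_prod f f) M = (\<lambda>x. (x, x)) ` S"
    "Inv (map_prod f f) M \<subseteq> (top_of_set (X \<times> X)) interior_of M"
proof -
  let ?D = "(\<lambda>x. (x, x)) ` S"
  let ?F = "map_prod f f"
  obtain I where I: "I \<subseteq> X" "compact I" "S = Inv f I" "S \<subseteq> (top_of_set X) interior_of I"
    using isol by (auto simp: isolated_invariant_set_def)
  have SI: "S \<subseteq> I" using I(3) Inv_subset by simp
  have fS: "f ` S = S" using I(3) image_Inv by simp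
  have "compact S"
    using I compact_Inv contf continuous_on_subset by metis
  then have D: "compact ?D"
    by (intro compact_continuous_image continuous_intros)
  have "{(x, x) |x. x \<in> S} = ?D" by auto
  then obtain J where J: "?D = Inv ?F J" "?D \<subseteq> (top_of_set (S \<times> S)) interior_of J"
    using exps unfolding expansive_on_def expansive_def isolated_invariant_set_def by auto
  obtain U where U: "open U" "(top_of_set (S \<times> S)) interior_of J = (S \<times> S) \<inter> U"
    by (metis openin_interior_of openin_open)
  have "?D \<subseteq> U" using J(2) U(2) by blast
  then obtain d where d: "d > 0" "(\<Union>p\<in>?D. ball p d) \<subseteq> U"
    using compact_subset_open_imp_ball_epsilon_subset[OF D U(1)] by metis
  have near: "(x, y) \<in> J" if "x \<in> S" "y \<in> S" "dist x y < d" for x y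
  proof -
    have "(x, y) \<in> ball (x, x) d" using that(3) by (simp add: dist_Pair_Pair)
    then have "(x, y) \<in> U" using d(2) that(1) by blast
    then show ?thesis using U(2) that(1,2) interior_of_subset[of "top_of_set (S \<times> S)" J] by auto
  qed
  \<comment> \<open>Halving \<open>d\<close> gives \<open>m < d\<close> strictly, as
    \<open>M\<close> is cut out by a non-strict inequality but \<open>near\<close> needs a strict
    one.\<close>
  define m where "m = min \<eta> (d / 2)"
  have m: "0 < m" "m \<le> \<eta>" "m < d" using d(1) \<open>0 < \<eta>\<close> by (auto simp: m_def)
  define M where "M = (I \<times> I) \<inter> {p. dist (fst p) (snd p) \<le> m}"
  have "closed {p::'a \<times> 'a. dist (fst p) (snd p) \<le> m}"
    by (intro closed_Collect_le continuous_intros)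
  then have M: "compact M"
    using I(2) by (simp add: M_def compact_Times compact_Int_closed)
  have "fst ` Inv ?F M \<subseteq> S" "snd ` Inv ?F M \<subseteq> S"
  proof -
    have *: "?F ` Inv ?F M = Inv ?F M" by (rule image_Inv)
    have "f ` fst ` Inv ?F M = fst ` ?F ` Inv ?F M" "f ` snd ` Inv ?F M = snd ` ?F ` Inv ?F M"
      by (simp_all add: image_image)
    then have "invariant_set f (fst ` Inv ?F M)" "invariant_set f (snd ` Inv ?F M)"
      unfolding * by (simp_all add: invariant_set_def)
    moreover have "fst ` Inv ?F M \<subseteq> I" "snd ` Inv ?F M \<subseteq> I"
      using Inv_subset[of ?F M] by (auto simp: M_def)
    ultimately show "fst ` Inv ?F M \<subseteq> S" "snd ` Inv ?F M \<subseteq> S"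
      unfolding I(3) by (simp_all only: Inv_greatest)
  qed
  then have "Inv ?F M \<subseteq> S \<times> S" by force
  then have "Inv ?F M \<subseteq> J"
    using Inv_subset[of ?F M] near m(3) by (fastforce simp: M_def)
  then have "Inv ?F M \<subseteq> ?D"
    unfolding J(1) using Inv_invariant by (rule Inv_greatest)
  moreover have "?D \<subseteq> Inv ?F M"
  proof (rule Inv_greatest)
    show "?D \<subseteq> M" using SI m(1) by (auto simp: M_def)
    have "?F ` ?D = (\<lambda>x. (x, x)) ` f ` S" by (simp add: image_image)
    then show "invariant_set ?F ?D" by (simp add: invariant_set_def fS)
  qed
  ultimately have K: "Inv ?F M = ?D" by blast
  obtain V where V: "open V" "(top_of_set X) interior_of I = X \<inter> V"
    by (metis openin_interior_of openin_open)
  have VI: "X \<inter> V \<subseteq> I" using V(2) interior_of_subset by metis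
  \<comment> \<open>The strict version of the condition defining \<open>M\<close>, an open witness
    that the diagonal is interior.\<close>
  let ?W = "V \<times> V \<inter> {p. dist (fst p) (snd p) < m}"
  have "open ?W"
    using V(1) by (intro open_Int open_Times open_Collect_less continuous_intros)
  moreover have "(X \<times> X) \<inter> ?W \<subseteq> M" using VI by (auto simp: M_def)
  ultimately have "(X \<times> X) \<inter> ?W \<subseteq> (top_of_set (X \<times> X)) interior_of M"
    by (intro interior_of_maximal) auto
  moreover have "?D \<subseteq> (X \<times> X) \<inter> ?W" using I(4) V(2) m(1) by auto
  ultimately have "Inv ?F M \<subseteq> (top_of_set (X \<times> X)) interior_of M"
    unfolding K by blast
  with that[OF I(1-3) M _ _ K] show thesis
    using m(2) by (force simp: M_def)
qed

section \<open>Index systems\<close>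

text \<open>A point \<open>x i\<close> of an orbit following the chain avoids
  \<open>L (a i)\<close>, whose image misses the next set, and is interior to
  \<open>N (a i)\<close>, or else its predecessor would be in the exit set. Hence it lies in the
  open set interior minus \<open>L (a i)\<close>.\<close>

lemma allowable_isolating_neighborhood_chain:
  fixes X :: "'a::metric_space set"
  assumes pairs: "\<And>a. a \<in> A \<Longrightarrow> compact (N a) \<and> N a \<subseteq> X \<and> compact (L a)" and "compact X"
    and allow: "allowable X f A N L a"
  shows "isolating_neighborhood_chain X f (difference_chain X N L a)"
  unfolding isolating_neighborhood_chain_def
proof (intro conjI allI impI)
  let ?C = "difference_chain X N L a"
  have A: "a i \<in> A" for i using allow by (simp add: allowable_def)
  have prec: "exit_set X f (N (a i)) (N (a (i + 1))) \<subseteq> top_of_set (N (a i)) interior_of L (a i)"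
    "f ` L (a i) \<inter> top_of_set X closure_of (N (a (i + 1)) - L (a (i + 1))) = {}" for i
    using allow by (auto simp: allowable_def precedes_def)
  have closed_X: "closed X" using \<open>compact X\<close> compact_imp_closed by blast
  have C: "?C i = closure (N (a i) - L (a i))" for i
  proof -
    have "N (a i) - L (a i) \<subseteq> X" using pairs[OF A, of i] by blast
    then show ?thesis
      using closed_X by (simp add: difference_chain_def closure_of_subtopology inf_absorb1 inf_absorb2 closure_minimal)
  qed
  have CN: "?C i \<subseteq> N (a i)" for i
    unfolding C using pairs[OF A, of i] by (intro compact_closure_subset(1)) auto
  show CX: "?C i \<subseteq> X" for i using CN pairs[OF A, of i] by blast
  show "compact (?C i)" for i
    unfolding C using pairs[OF A, of i] by (intro compact_closure_subset(2)[of "N (a i)"]) auto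
  fix x i
  assume "orbit_in X f x \<and> follows x ?C"
  then have x: "\<And>i. x i \<in> X" "\<And>i. f (x i) = x (i + 1)" "\<And>i. x i \<in> ?C i"
    by (auto simp: orbit_in_def follows_def)
  have "x i \<notin> L (a i)"
    using prec(2)[of i] x(2)[of i] x(3)[of "i + 1"] by (auto simp: difference_chain_def)
  moreover have "x i \<in> top_of_set X interior_of N (a i)"
  proof (rule ccontr)
    assume "x i \<notin> top_of_set X interior_of N (a i)"
    moreover have xN: "x (i - 1) \<in> N (a (i - 1))" using x(3) CN by blast
    ultimately have "x (i - 1) \<in> top_of_set (N (a (i - 1))) interior_of L (a (i - 1))"
      using prec(1)[of "i - 1"] x(2)[of "i - 1"] by (auto simp: exit_set_def)
    then obtain T where "open T" "x (i - 1) \<in> T" "N (a (i - 1)) \<inter> T \<subseteq> L (a (i - 1))"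
      by (auto simp: interior_of_def openin_open)
    \<comment> \<open>Being interior to \<open>L\<close> relative to \<open>N\<close> excludes the
      predecessor from the closure of the difference, where it was assumed to be.\<close>
    then have "x (i - 1) \<notin> closure (N (a (i - 1)) - L (a (i - 1)))"
      using open_Int_closure_eq_empty[of T "N (a (i - 1)) - L (a (i - 1))"] by blast
    then show False using x(3) C by blast
  qed
  moreover have "openin (top_of_set X) (top_of_set X interior_of N (a i) - L (a i))"
  proof -
    obtain T where T: "open T" "top_of_set X interior_of N (a i) = X \<inter> T"
      by (metis openin_interior_of openin_open)
    have "open (T - L (a i))"
      using T(1) pairs[OF A, of i] by (blast intro: compact_imp_closed open_Diff)
    moreover have "top_of_set X interior_of N (a i) - L (a i) = X \<inter> (T - L (a i))"
      using T(2) by blast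
    ultimately show ?thesis by (auto simp: openin_open)
  qed
  moreover have "top_of_set X interior_of N (a i) - L (a i) \<subseteq> ?C i"
    unfolding C using closure_subset[of "N (a i) - L (a i)"] interior_of_subset[of "top_of_set X" "N (a i)"] by blast
  ultimately show "x i \<in> top_of_set X interior_of ?C i"
    using interior_of_maximal by blast
qed

section \<open>Fibres of a filtration pair\<close>

lemma continuous_on_map_prod:
  assumes "continuous_on A f" "continuous_on B g"
  shows "continuous_on (A \<times> B) (map_prod f g)"
proof -
  have "continuous_on (A \<times> B) (\<lambda>p. (f (fst p), g (snd p)))"
    by (intro continuous_on_Pair continuous_on_compose2[OF assms(1)] continuous_on_compose2[OF assms(2)]
        continuous_on_fst continuous_on_snd continuous_on_id) auto
  then show ?thesis by (simp add: map_prod_def case_prod_unfold)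
qed

text \<open>Both filtration conditions hold with a uniform margin by compactness. Replacing
  \<open>(f x, f y)\<close> by \<open>(x', f y)\<close> moves a point by
  \<open>dist (f x) x'\<close> only, so they survive when this is below both margins.\<close>

lemma fibre_precedes:
  fixes f :: "'a::metric_space \<Rightarrow> 'a"
  assumes "compact P" "compact Q" "Q \<subseteq> P" "P \<subseteq> X \<times> X" "continuous_on X f" "f ` X \<subseteq> X"
    and exit: "map_prod f f ` closure (P - Q) \<subseteq> top_of_set (X \<times> X) interior_of P"
    and entry: "map_prod f f ` Q \<inter> closure (P - Q) = {}"
  obtains e where "0 < e"
    "\<forall>x\<in>X. \<forall>x'\<in>X. dist (f x) x' < e \<longrightarrow>
       precedes X f (Pair x -` P, Pair x -` Q) (Pair x' -` P, Pair x' -` Q)"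
proof -
  let ?F = "map_prod f f" and ?E = "closure (P - Q)"
  have EP: "?E \<subseteq> P"
    using assms(1) by (intro compact_closure_subset(1)) auto
  have E: "compact ?E"
    using assms(1) by (intro compact_closure_subset(2)[of P]) auto
  have contF: "continuous_on T ?F" if "T \<subseteq> P" for T
    using continuous_on_map_prod[OF assms(5) assms(5)] that assms(4)
    by (meson continuous_on_subset subset_trans)
  obtain U where U: "open U" "top_of_set (X \<times> X) interior_of P = (X \<times> X) \<inter> U"
    by (metis openin_interior_of openin_open)
  have UP: "(X \<times> X) \<inter> U \<subseteq> P" using U(2) interior_of_subset by metis
  have FE: "compact (?F ` ?E)" using compact_continuous_image contF EP E by blast
  have "?F ` ?E \<subseteq> U" using exit U(2) by blast
  then obtain d where d: "0 < d" "(\<Union>p\<in>?F ` ?E. ball p d) \<subseteq> U"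
    using compact_subset_open_imp_ball_epsilon_subset[OF FE U(1)] by metis
  have FQ: "compact (?F ` Q)" using compact_continuous_image contF assms(2,3) by blast
  have "?F ` Q \<subseteq> - ?E" using entry by blast
  then obtain c where c: "0 < c" "(\<Union>p\<in>?F ` Q. ball p c) \<subseteq> - ?E"
    using compact_subset_open_imp_ball_epsilon_subset[OF FQ, of "- ?E"] open_Compl closed_closure
    by metis
  show thesis
  proof (rule that[of "min c d"])
    show "0 < min c d" using c d by simp
    show "\<forall>x\<in>X. \<forall>x'\<in>X. dist (f x) x' < min c d \<longrightarrow>
       precedes X f (Pair x -` P, Pair x -` Q) (Pair x' -` P, Pair x' -` Q)"
    proof (intro ballI impI)
      fix x x' assume x: "x \<in> X" "x' \<in> X" "dist (f x) x' < min c d"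
      have "y \<in> top_of_set (Pair x -` P) interior_of (Pair x -` Q)"
        if y: "(x, y) \<in> P" "f y \<notin> top_of_set X interior_of (Pair x' -` P)" for y
      proof -
        \<comment> \<open>Exit points avoid \<open>closure (P - Q)\<close>, whose open complement
          meets the fibre of \<open>P\<close> only inside that of \<open>Q\<close>.\<close>
        have "(x, y) \<notin> ?E"
        proof
          assume "(x, y) \<in> ?E"
          moreover have "(x', f y) \<in> ball (?F (x, y)) d"
            using x(3) by (simp add: dist_Pair_Pair)
          ultimately have "(x', f y) \<in> U" using d(2) by blast
          have fy: "f y \<in> X" using y(1) assms(4,6) by blast
          have "open (Pair x' -` U)"
            by (intro open_vimage U(1) continuous_intros)
          moreover have "X \<inter> Pair x' -` U \<subseteq> Pair x' -` P" using UP x(2) by blast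
          ultimately have "X \<inter> Pair x' -` U \<subseteq> top_of_set X interior_of (Pair x' -` P)"
            by (intro interior_of_maximal) auto
          then show False using y(2) fy \<open>(x', f y) \<in> U\<close> by blast
        qed
        have "open (Pair x -` (- ?E))"
          by (intro open_vimage continuous_intros) auto
        moreover have "Pair x -` P \<inter> Pair x -` (- ?E) \<subseteq> Pair x -` Q"
          using closure_subset[of "P - Q"] by blast
        ultimately have "Pair x -` P \<inter> Pair x -` (- ?E) \<subseteq>
            top_of_set (Pair x -` P) interior_of (Pair x -` Q)"
          by (intro interior_of_maximal) auto
        then show ?thesis using y(1) \<open>(x, y) \<notin> ?E\<close> by blast
      qed
      moreover have "f y \<notin> top_of_set X closure_of (Pair x' -` P - Pair x' -` Q)"
        if y: "(x, y) \<in> Q" for y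
      proof
        assume "f y \<in> top_of_set X closure_of (Pair x' -` P - Pair x' -` Q)"
        then have "f y \<in> closure (Pair x' -` P - Pair x' -` Q)"
          using closure_of_subtopology_subset[of euclidean X "Pair x' -` P - Pair x' -` Q"] by auto
        \<comment> \<open>The closure of a fibre may be smaller than the fibre of the closure; this
          inclusion suffices.\<close>
        moreover have "closure (Pair x' -` P - Pair x' -` Q) \<subseteq> Pair x' -` ?E"
          by (intro closure_minimal closed_vimage continuous_intros)
            (use closure_subset[of "P - Q"] in auto)
        moreover have "(x', f y) \<in> ball (?F (x, y)) c"
          using x(3) by (simp add: dist_Pair_Pair)
        ultimately show False using c(2) y by blast
      qed
      ultimately show "precedes X f (Pair x -` P, Pair x -` Q) (Pair x' -` P, Pair x' -` Q)"
        by (auto simp: precedes_def exit_set_def)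
    qed
  qed
qed

lemma compact_fibre:
  fixes P :: "('a::metric_space \<times> 'b::metric_space) set"
  assumes "compact P"
  shows "compact (Pair x -` P)"
proof -
  have "Pair x -` P = snd ` (P \<inter> {x} \<times> UNIV)" by force
  moreover have "compact (P \<inter> {x} \<times> UNIV)"
    using assms by (intro compact_Int_closed closed_Times) auto
  ultimately show ?thesis
    by (simp add: compact_continuous_image continuous_on_snd continuous_on_id)
qed

lemma diameter_cball_subset:
  fixes T :: "'a::metric_space set"
  assumes "T \<subseteq> cball x r" "0 \<le> r"
  shows "diameter T \<le> 2 * r"
proof (cases "T = {}")
  case False
  have "dist y z \<le> 2 * r" if "y \<in> T" "z \<in> T" for y z
  proof -
    have "dist x y \<le> r" "dist x z \<le> r" using assms(1) that by auto
    then show ?thesis using dist_triangle3[of y z x] by linarith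
  qed
  then show ?thesis
    using False by (auto simp: diameter_def intro!: cSUP_least)
qed (use assms in simp)

text \<open>The net is enumerated by natural numbers to provide an index set of type
  \<open>nat set\<close>, whatever the type of the points.\<close>

lemma finite_net:
  fixes S :: "'a::metric_space set"
  assumes "compact S" "0 < e"
  obtains A :: "nat set" and h where "finite A" "h ` A \<subseteq> S"
    "\<forall>x\<in>S. \<exists>a\<in>A. dist x (h a) < e"
proof -
  obtain G where G: "finite G" "G \<subseteq> S" "S \<subseteq> (\<Union>x\<in>G. ball x e)"
  proof (rule compactE_image[OF assms(1), of S "\<lambda>x. ball x e"])
    show "S \<subseteq> (\<Union>x\<in>S. ball x e)" using assms(2) by auto
  qed (use that in auto)
  obtain h where h: "bij_betw h {0..<card G} G"
    using ex_bij_betw_nat_finite[OF G(1)] by blast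
  have hG: "h ` {0..<card G} = G" using h by (simp add: bij_betw_def)
  show thesis
  proof (rule that[of "{0..<card G}" h])
    show "h ` {0..<card G} \<subseteq> S" using hG G(2) by simp
    show "\<forall>x\<in>S. \<exists>a\<in>{0..<card G}. dist x (h a) < e"
    proof
      fix x assume "x \<in> S"
      then have "x \<in> (\<Union>y\<in>G. ball y e)" using G(3) by (rule subsetD[rotated])
      then obtain g where g: "g \<in> G" "dist x g < e"
        by (auto simp: dist_commute)
      have "g \<in> h ` {0..<card G}" using g(1) by (simp add: hG)
      then show "\<exists>a\<in>{0..<card G}. dist x (h a) < e" using g(2) by blast
    qed
  qed simp
qed

section \<open>The index system of fibres over a finite net of \<open>S\<close>\<close>

theorem theorem9:
  fixes X S :: "'a::metric_space set" and f :: "'a \<Rightarrow> 'a"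
  assumes "compact X"
    and "continuous_on X f" and "f ` X \<subseteq> X"
    and "isolated_invariant_set X f S"
    and "expansive_on f S"
  shows "\<forall>\<eta>>0. \<exists>(A :: nat set) N L.
           index_system_for X f S A N L \<and> (\<forall>a\<in>A. diameter (N a) < \<eta>)"
proof (intro allI impI)
  fix \<eta> :: real assume "0 < \<eta>"
  let ?F = "map_prod f f" and ?D = "(\<lambda>x. (x, x)) ` S"
  \<comment> \<open>Fibres will lie in closed balls of radius \<open>\<eta> / 3\<close>, so their
    diameters are at most two thirds of \<open>\<eta>\<close>.\<close>
  have "0 < \<eta> / 3" using \<open>0 < \<eta>\<close> by simp
  then obtain I M where I: "I \<subseteq> X" "compact I" "S = Inv f I" and M: "compact M" "M \<subseteq> I \<times> I"
    "M \<subseteq> {p. dist (fst p) (snd p) \<le> \<eta> / 3}"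
    "Inv ?F M = ?D" "Inv ?F M \<subseteq> (top_of_set (X \<times> X)) interior_of M"
    by (rule isolated_diagonal[OF assms(2,4,5)])
  have MX: "M \<subseteq> X \<times> X" using M(2) I(1) by blast
  have SX: "S \<subseteq> X" using I(1,3) Inv_subset[of f I] by simp
  have fS: "f ` S = S" using I(3) image_Inv by simp
  interpret compact_domain ?F M
    using M(1) continuous_on_subset[OF continuous_on_map_prod[OF assms(2) assms(2)] MX]
    by unfold_locales
  have "?F ` (X \<times> X) \<subseteq> X \<times> X" using assms(3) by auto
  then obtain P Q where PQ: "compact P" "compact Q" "Q \<subseteq> P" "P \<subseteq> M"
    "?F ` closure (P - Q) \<subseteq> (top_of_set (X \<times> X)) interior_of P"
    "?F ` Q \<inter> closure (P - Q) = {}"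
    "Inv ?F M \<subseteq> (top_of_set (X \<times> X)) interior_of (P - Q)"
    by (rule filtration_pair[OF _ MX M(5)])
  have PX: "P \<subseteq> X \<times> X" using PQ(4) MX by blast
  obtain e where e: "0 < e" "\<forall>x\<in>X. \<forall>x'\<in>X. dist (f x) x' < e \<longrightarrow>
       precedes X f (Pair x -` P, Pair x -` Q) (Pair x' -` P, Pair x' -` Q)"
    by (rule fibre_precedes[OF PQ(1-3) PX assms(2,3) PQ(5,6)])
  have cS: "compact S"
    using compact_Inv[OF I(2) continuous_on_subset[OF assms(2) I(1)]] I(3) by simp
  have "compact ?D" using cS by (intro compact_continuous_image continuous_intros)
  obtain U where U: "open U" "top_of_set (X \<times> X) interior_of (P - Q) = (X \<times> X) \<inter> U"
    by (metis openin_interior_of openin_open)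
  have "?D \<subseteq> U" using PQ(7) M(4) U(2) by blast
  then obtain c where c: "0 < c" "(\<Union>p\<in>?D. ball p c) \<subseteq> U"
    using compact_subset_open_imp_ball_epsilon_subset[OF \<open>compact ?D\<close> U(1)] by metis
  \<comment> \<open>For nearby points of \<open>S\<close>, each lies in the fibre of
    \<open>P - Q\<close> over the other; this puts orbits in \<open>S\<close> into the difference
    chain.\<close>
  have near: "(x, y) \<in> P - Q" if "x \<in> S" "y \<in> S" "dist y x < c" for x y
  proof -
    have "(x, y) \<in> ball (y, y) c" using that(3) by (simp add: dist_Pair_Pair)
    then have "(x, y) \<in> (X \<times> X) \<inter> U" using c(2) that(1,2) SX by blast
    then show ?thesis using U(2) interior_of_subset[of "top_of_set (X \<times> X)" "P - Q"] by auto
  qed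
  have "uniformly_continuous_on X f"
    using assms(1,2) compact_uniformly_continuous by blast
  then obtain b where b: "0 < b"
    "\<And>x y. x \<in> X \<Longrightarrow> y \<in> X \<Longrightarrow> dist y x < b \<Longrightarrow> dist (f y) (f x) < e / 2"
    using e(1) unfolding uniformly_continuous_on_def by (metis half_gt_zero)
  \<comment> \<open>The parts \<open>e / 2\<close> and \<open>b\<close> make the net error plus its
    image under \<open>f\<close> less than \<open>e\<close>; the part \<open>c\<close> is for
    \<open>near\<close>.\<close>
  define r where "r = min (e / 2) (min b c)"
  have r: "0 < r" "r \<le> e / 2" "r \<le> b" "r \<le> c" using e(1) b(1) c(1) by (auto simp: r_def)
  obtain A :: "nat set" and h where A: "finite A" "h ` A \<subseteq> S"
    "\<forall>x\<in>S. \<exists>a\<in>A. dist x (h a) < r"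
    by (rule finite_net[OF cS r(1)])
  define N where "N a = Pair (h a) -` P" for a
  define L where "L a = Pair (h a) -` Q" for a
  have hS: "h a \<in> S" if "a \<in> A" for a using A(2) that by blast
  have NM: "N a \<subseteq> I" for a using PQ(4) M(2) by (auto simp: N_def)
  have pairs: "compact (N a) \<and> compact (L a) \<and> L a \<subseteq> N a \<and> N a \<subseteq> X" for a
  proof -
    have "L a \<subseteq> N a" using PQ(3) by (auto simp: N_def L_def)
    then show ?thesis using compact_fibre[OF PQ(1)] compact_fibre[OF PQ(2)] NM[of a] I(1)
      by (auto simp: N_def L_def)
  qed
  have prec: "precedes X f (N a, L a) (N a', L a')"
    if "a \<in> A" "a' \<in> A" "dist (f (h a)) (h a') < e" for a a'
    unfolding N_def L_def using e(2) hS[OF that(1)] hS[OF that(2)] SX that(3) by blast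
  have chain: "isolating_neighborhood_chain X f (difference_chain X N L a)"
    if "allowable X f A N L a" for a
    by (rule allowable_isolating_neighborhood_chain[OF _ assms(1) that]) (use pairs in blast)
  have "\<exists>b\<in>A. precedes X f (N a, L a) (N b, L b)" if "a \<in> A" for a
  proof -
    have "f (h a) \<in> S" using imageI[OF hS[OF that], of f] by (simp add: fS)
    then obtain b where "b \<in> A" "dist (f (h a)) (h b) < r" using A(3) by blast
    then show ?thesis using prec[OF that] r(2) e(1) by force
  qed
  then have sys: "index_system X f A N L"
    using A(1) pairs chain by (simp add: index_system_def)
  \<comment> \<open>All fibres lie in \<open>I\<close>, so an orbit following any chain stays in
    \<open>I\<close> and hence in \<open>Inv f I = S\<close>.\<close>
  have "Inv_system X f A N L \<subseteq> S"
  proof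
    fix y assume "y \<in> Inv_system X f A N L"
    then obtain a x where x: "orbit_in X f x" "x 0 = y" "\<And>i. x i \<in> difference_chain X N L a i"
      by (auto simp: Inv_system_def Inv0_def follows_def)
    have "difference_chain X N L a i \<subseteq> N (a i)" for i
    proof -
      have "closure (N (a i) - L (a i)) \<subseteq> N (a i)"
        using pairs by (intro compact_closure_subset(1)) auto
      then show ?thesis
        using closure_of_subtopology_subset[of euclidean X "N (a i) - L (a i)"]
        by (auto simp: difference_chain_def)
    qed
    then have "x i \<in> I" for i using x(3) NM by blast
    then show "y \<in> S" using orbit_in_Inv[OF x(1)] x(2) I(3) by blast
  qed
  moreover have "S \<subseteq> Inv_system X f A N L"
  proof
    fix y assume "y \<in> S"
    then obtain x where x: "orbit_in S f x" "x 0 = y"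
      using orbit_through_point[OF fS] by metis
    then have xS: "x i \<in> S" "f (x i) = x (i + 1)" for i by (auto simp: orbit_in_def)
    have "\<forall>i. \<exists>b. b \<in> A \<and> dist (x i) (h b) < r"
      using A(3) xS(1) by blast
    \<comment> \<open>The orbit is coded by net points near its terms; since
      \<open>x (i + 1)\<close> is \<open>f (x i)\<close>, consecutive ones are nearly related by
      \<open>f\<close>, and the coding is allowable.\<close>
    then obtain a where a: "\<And>i. a i \<in> A" "\<And>i. dist (x i) (h (a i)) < r"
      by metis
    have "dist (f (h (a i))) (h (a (i + 1))) < e" for i
    proof -
      have "dist (h (a i)) (x i) < b" using a(2)[of i] r(3) by (simp add: dist_commute)
      then have "dist (f (h (a i))) (x (i + 1)) < e / 2"
        using b(2)[of "x i" "h (a i)"] xS(2)[of i] subsetD[OF SX xS(1)[of i]]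
          subsetD[OF SX hS[OF a(1)[of i]]] by simp
      then show ?thesis
        using a(2)[of "i + 1"] r(2) dist_triangle[of "f (h (a i))" "h (a (i + 1))" "x (i + 1)"]
        by linarith
    qed
    then have allow: "allowable X f A N L a"
      using a(1) prec by (simp add: allowable_def)
    have "x i \<in> difference_chain X N L a i" for i
    proof -
      have "x i \<in> N (a i) - L (a i)"
        using near[of "h (a i)" "x i"] a[of i] hS xS(1) r(4) by (auto simp: N_def L_def)
      moreover have "N (a i) - L (a i) \<subseteq> topspace (top_of_set X)" using pairs by auto
      ultimately show ?thesis
        using closure_of_subset[of "N (a i) - L (a i)" "top_of_set X"]
        by (auto simp: difference_chain_def)
    qed
    moreover have "orbit_in X f x" using x(1) SX by (auto simp: orbit_in_def)
    ultimately have "y \<in> Inv0 X f (difference_chain X N L a)"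
      using x(2) by (auto simp: Inv0_def follows_def)
    then show "y \<in> Inv_system X f A N L"
      using allow by (auto simp: Inv_system_def)
  qed
  ultimately have "index_system_for X f S A N L"
    using sys by (auto simp: index_system_for_def)
  moreover have "diameter (N a) < \<eta>" for a
  proof -
    have "N a \<subseteq> cball (h a) (\<eta> / 3)" using PQ(4) M(3) by (auto simp: N_def)
    then have "diameter (N a) \<le> 2 * (\<eta> / 3)" using \<open>0 < \<eta>\<close> by (intro diameter_cball_subset) auto
    then show ?thesis using \<open>0 < \<eta>\<close> by linarith
  qed
  ultimately show "\<exists>(A :: nat set) N L.
      index_system_for X f S A N L \<and> (\<forall>a\<in>A. diameter (N a) < \<eta>)" by blast
qed

end
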